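(* Let $U_1,\dots,U_n\subset\mathbb{R}$ and $V_2\subset\mathbb{R}^m$ be open, $V_1=U_1\times\cdots\times U_n$. For $i=1,\dots,n$ let $G_i:U_i\to\mathbb{R}$ be continuous and $H_i:V_2\to\mathbb{R}$ be $C^1$, and for $x\in V_2$, $y=(y^1,\dots,y^n)\in V_1$, $j=1,\dots,m$ put $$F^{ij}(x,y)=G_i(y^i)\,\frac{\partial H_i}{\partial x^j}(x).$$ Then the partial differential equation $$\frac{\partial y^i}{\partial x^j}=F^{ij}(x,y(x)),\qquad i=1,\dots,n,\ j=1,\dots,m,$$ admits solutions through every point: for every $(x_0,y_0)\in V_2\times V_1$ there is a $C^1$ solution $y$ defined on a neighbourhood of $x_0$ with $y(x_0)=y_0$. *)

theory Defs
  imports "HOL-Analysis.Analysis"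
begin

text \<open>A map is of class C1 on an open set if it is Frechet differentiable at every point and the
  derivative is continuous with respect to the operator norm.\<close>

definition C1_on :: "('a::real_normed_vector \<Rightarrow> 'b::real_normed_vector) \<Rightarrow> 'a set \<Rightarrow> bool" where
  "C1_on f S \<longleftrightarrow> open S \<and>
     (\<exists>f' :: 'a \<Rightarrow> 'a \<Rightarrow>\<^sub>L 'b.
        (\<forall>x\<in>S. (f has_derivative blinfun_apply (f' x)) (at x)) \<and> continuous_on S f')"

text \<open>The value is unspecified where the one-variable derivative does not exist; it does exist at
  every point of a set on which \<open>f\<close> is C1.\<close>

definition partial_deriv :: "'m::finite \<Rightarrow> (real ^ 'm \<Rightarrow> real) \<Rightarrow> real ^ 'm \<Rightarrow> real" where
  "partial_deriv j f x = deriv (\<lambda>t::real. f (x + t *\<^sub>R axis j 1)) 0"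

end

theory Submission
  imports Defs
begin

text \<open>The system decouples: with \<open>\<phi>\<^sub>i\<close> a local solution of the autonomous scalar equation
  \<open>\<phi>' = G\<^sub>i(\<phi>)\<close>, \<open>\<phi>(0) = y\<^sub>0\<^sup>i\<close>, the chain rule shows that
  \<open>y\<^sup>i(x) = \<phi>\<^sub>i(H\<^sub>i(x) - H\<^sub>i(x\<^sub>0))\<close> solves it. Since \<open>G\<^sub>i\<close> is only continuous, \<open>\<phi>\<^sub>i\<close> is obtained by
  separation of variables: it is constant if \<open>G\<^sub>i\<close> vanishes at the initial value, and otherwise the
  local inverse of an antiderivative of \<open>1 / G\<^sub>i\<close>.\<close>

lemma autonomous_ode_local_solution:
  fixes G :: "real \<Rightarrow> real"
  assumes "open U" "continuous_on U G" "a \<in> U"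
  shows "\<exists>e>0. \<exists>\<phi>. \<phi> 0 = a \<and>
    (\<forall>t. \<bar>t\<bar> < e \<longrightarrow> \<phi> t \<in> U \<and> (\<phi> has_real_derivative G (\<phi> t)) (at t))"
proof (cases "G a = 0")
  case True
  then show ?thesis
    using \<open>a \<in> U\<close> by (intro exI[of _ 1] conjI exI[of _ "\<lambda>_. a"]) auto
next
  case False
  \<comment> \<open>Since \<open>G\<close> is continuous, it stays nonzero on a whole closed
    interval of radius \<open>d\<close> around \<open>a\<close>, so \<open>1 / G\<close> can be
    integrated there.\<close>
  have "open {s \<in> U. G s \<noteq> 0}"
    using continuous_open_preimage[OF assms(2,1), of "- {0}"]
    by (simp add: vimage_def Int_def open_Compl)
  moreover have "a \<in> {s \<in> U. G s \<noteq> 0}"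
    using False \<open>a \<in> U\<close> by simp
  ultimately obtain d where d: "d > 0" "cball a d \<subseteq> {s \<in> U. G s \<noteq> 0}"
    using open_contains_cball by blast
  have inU: "s \<in> U" and nz: "G s \<noteq> 0" if "s \<in> {a - d..a + d}" for s
    using d(2) that by (auto simp: subset_iff cball_eq_atLeastAtMost)
  let ?I = "{a - d<..<a + d}"
  \<comment> \<open>The integral starts at the left endpoint \<open>a - d\<close> because an
    integral over \<open>{a..s}\<close> would be 0 for every \<open>s < a\<close>. Subtracting the
    value at \<open>a\<close> normalises \<open>K a = 0\<close>, which later yields
    \<open>\<phi> 0 = a\<close>.\<close>
  define K where "K s = integral {a - d..s} (\<lambda>r. inverse (G r)) - integral {a - d..a} (\<lambda>r. inverse (G r))" for s
  have "continuous_on {a - d..a + d} (\<lambda>r. inverse (G r))"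
    using nz inU by (intro continuous_on_inverse continuous_on_subset[OF assms(2)]) auto
  then have K: "(K has_real_derivative inverse (G s)) (at s)" if "s \<in> ?I" for s
    using integral_has_real_derivative[of "a - d" "a + d" "\<lambda>r. inverse (G r)" s] that
    unfolding K_def
    by (auto intro!: derivative_eq_intros simp: at_within_Icc_at)
  have contK: "continuous_on ?I K"
    using K by (intro DERIV_continuous_on[of _ _ "\<lambda>s. inverse (G s)"])
      (auto intro: has_field_derivative_at_within)
  \<comment> \<open>Two equal values of \<open>K\<close> would, by Rolle, force its derivative
    \<open>inverse (G z)\<close> to vanish at some \<open>z\<close> in between, although
    \<open>G z\<close> is nonzero.\<close>
  have False if "p \<in> ?I" "q \<in> ?I" "p < q" "K p = K q" for p q
  proof -
    have sub: "{p..q} \<subseteq> ?I"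
      using that by auto
    have "(K has_derivative (*) (inverse (G s))) (at s)" if "p < s" "s < q" for s
      using K[OF subsetD[OF sub, of s]] that by (simp add: has_field_derivative_def)
    from Rolle_deriv[OF \<open>p < q\<close> \<open>K p = K q\<close> continuous_on_subset[OF contK sub] this]
    obtain z where z: "p < z" "z < q" "(*) (inverse (G z)) = (\<lambda>v. 0)"
      by blast
    have "inverse (G z) * 1 = 0"
      by (simp only: z(3))
    then show False
      using nz[of z] z(1,2) that by simp
  qed
  then have inj: "inj_on K ?I"
    by (metis inj_onI linorder_neqE)
  let ?\<phi> = "inv_into ?I K"
  \<comment> \<open>The image is an open set containing \<open>K a = 0\<close>, so it contains a
    ball around 0; its radius \<open>e\<close> is the lifetime of the solution.\<close>
  have "open (K ` ?I)"
    by (rule invariance_of_domain[OF contK _ inj]) simp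
  moreover have "0 \<in> K ` ?I"
    using d(1) by (intro image_eqI[of _ _ a]) (auto simp: K_def)
  ultimately obtain e where e: "e > 0" "ball 0 e \<subseteq> K ` ?I"
    using open_contains_ball by blast
  have \<phi>: "?\<phi> t \<in> U \<and> (?\<phi> has_real_derivative G (?\<phi> t)) (at t)" if "\<bar>t\<bar> < e" for t
  proof -
    have t: "t \<in> K ` ?I"
      using e(2) that by (auto simp: subset_iff)
    let ?s = "?\<phi> t"
    have s: "?s \<in> ?I" "K ?s = t"
      using inv_into_into[OF t] f_inv_into_f[OF t] by auto
    \<comment> \<open>The derivative of the inverse function is the reciprocal of
      \<open>inverse (G ?s)\<close>, that is \<open>G ?s\<close> with \<open>?s = ?\<phi> t\<close>:
      exactly the differential equation.\<close>
    have "(?\<phi> has_derivative (*) (G ?s)) (at (K ?s))"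
      using K[OF s(1)] s(1) nz[of ?s] inj contK unfolding has_field_derivative_def
      by (intro has_derivative_inverse_strong[of ?I ?s K ?\<phi>]) (auto simp: fun_eq_iff)
    then show ?thesis
      using s inU[of ?s] by (auto simp: has_field_derivative_def)
  qed
  have "?\<phi> 0 = a"
    using d(1) inv_into_f_f[OF inj, of a] by (simp add: K_def)
  with \<phi> e(1) show ?thesis
    by blast
qed

text \<open>This is the chain rule along the line through \<open>x\<close> in direction
  \<open>axis j 1\<close>. Applied to both \<open>H i\<close> and the components of
  \<open>y\<close>, it turns the differential equation into an identity between Frechet
  derivatives.\<close>

lemma partial_deriv_eq:
  assumes "(f has_derivative f') (at x)"
  shows "partial_deriv j f x = f' (axis j 1)"
proof -
  interpret f': bounded_linear f'
    using assms by (rule has_derivative_bounded_linear)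
  have "((\<lambda>t::real. x + t *\<^sub>R axis j 1) has_derivative (\<lambda>t. t *\<^sub>R axis j 1)) (at 0)"
    by (auto intro!: derivative_eq_intros)
  from has_derivative_compose[OF this, of f f'] assms
  have "((\<lambda>t. f (x + t *\<^sub>R axis j 1)) has_real_derivative f' (axis j 1)) (at 0)"
    by (simp add: has_field_derivative_def f'.scaleR mult_commute_abs)
  then show ?thesis
    unfolding partial_deriv_def by (rule DERIV_imp_deriv)
qed

theorem proposition1p8:
  fixes U :: "'n::finite \<Rightarrow> real set"
    and V1 :: "(real ^ 'n) set"
    and V2 :: "(real ^ 'm::finite) set"
    and G :: "'n \<Rightarrow> real \<Rightarrow> real"
    and H :: "'n \<Rightarrow> real ^ 'm \<Rightarrow> real"
    and F :: "'n \<Rightarrow> 'm \<Rightarrow> real ^ 'm \<Rightarrow> real ^ 'n \<Rightarrow> real"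
  assumes "\<And>i. open (U i)"
    and "open V2"
    and "V1 = {y. \<forall>i. y $ i \<in> U i}"
    and "\<And>i. continuous_on (U i) (G i)"
    and "\<And>i. C1_on (H i) V2"
    and "\<And>i j x y. x \<in> V2 \<Longrightarrow> y \<in> V1 \<Longrightarrow> F i j x y = G i (y $ i) * partial_deriv j (H i) x"
  shows "\<forall>x0\<in>V2. \<forall>y0\<in>V1. \<exists>W y. open W \<and> x0 \<in> W \<and> W \<subseteq> V2 \<and>
           C1_on y W \<and> (\<forall>x\<in>W. y x \<in> V1) \<and>
           (\<forall>x\<in>W. \<forall>i j. partial_deriv j (\<lambda>x'. y x' $ i) x = F i j x (y x)) \<and>
           y x0 = y0"
proof (intro ballI)
  fix x0 y0
  assume x0: "x0 \<in> V2" and y0: "y0 \<in> V1"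
  have "\<forall>i. \<exists>e \<phi>. e > 0 \<and> \<phi> 0 = y0 $ i \<and>
      (\<forall>t. \<bar>t\<bar> < e \<longrightarrow> \<phi> t \<in> U i \<and> (\<phi> has_real_derivative G i (\<phi> t)) (at t))"
    using autonomous_ode_local_solution[OF assms(1) assms(4)] y0 assms(3) by blast
  then obtain e \<phi> where e: "\<And>i. e i > 0" and \<phi>0: "\<And>i. \<phi> i 0 = y0 $ i"
    and \<phi>U: "\<And>i t. \<bar>t\<bar> < e i \<Longrightarrow> \<phi> i t \<in> U i"
    and \<phi>: "\<And>i t. \<bar>t\<bar> < e i \<Longrightarrow> (\<phi> i has_real_derivative G i (\<phi> i t)) (at t)"
    by metis
  have "\<forall>i. \<exists>H' :: real ^ 'm \<Rightarrow> (real ^ 'm) \<Rightarrow>\<^sub>L real.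
      (\<forall>x\<in>V2. (H i has_derivative blinfun_apply (H' x)) (at x)) \<and> continuous_on V2 H'"
    using assms(5) by (auto simp: C1_on_def)
  then obtain H' :: "'n \<Rightarrow> real ^ 'm \<Rightarrow> (real ^ 'm) \<Rightarrow>\<^sub>L real"
    where H': "\<And>i x. x \<in> V2 \<Longrightarrow> (H i has_derivative blinfun_apply (H' i x)) (at x)"
      and contH': "\<And>i. continuous_on V2 (H' i)"
    by metis
  have contH: "continuous_on V2 (H i)" for i
    using H' by (meson has_derivative_at_withinI has_derivative_continuous_on)
  \<comment> \<open>On \<open>W\<close> each increment \<open>H i x - H i x0\<close> stays in the
    interval where \<open>\<phi> i\<close> solves its equation. The intersection is open because the
    index type is finite.\<close>
  define W where "W = (\<Inter>i. V2 \<inter> H i -` ball (H i x0) (e i))"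
  define y :: "real ^ 'm \<Rightarrow> real ^ 'n" where "y x = (\<chi> i. \<phi> i (H i x - H i x0))" for x
  have "open W"
    unfolding W_def using contH assms(2) by (intro open_INT ballI) (auto intro: continuous_open_preimage)
  have "x0 \<in> W"
    using x0 e by (simp add: W_def)
  have "W \<subseteq> V2"
    by (auto simp: W_def)
  have W: "\<bar>H i x - H i x0\<bar> < e i" if "x \<in> W" for i x
    using that by (auto simp: W_def dist_real_def abs_minus_commute)
  have yV: "y x \<in> V1" if "x \<in> W" for x
    using \<phi>U W[OF that] by (simp add: assms(3) y_def)
  have y': "((\<lambda>x. y x $ i) has_derivative (\<lambda>h. G i (y x $ i) * H' i x h)) (at x)" if "x \<in> W" for i x
  proof -
    have "((\<lambda>x. H i x - H i x0) has_derivative blinfun_apply (H' i x)) (at x)"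
      using H' \<open>W \<subseteq> V2\<close> that by (auto intro!: derivative_eq_intros)
    from has_derivative_compose[OF this, of "\<phi> i"] \<phi>[OF W[OF that]] show ?thesis
      by (simp add: has_field_derivative_def y_def)
  qed
  \<comment> \<open>The derivative of \<open>y\<close> is written as a finite sum of rank-one
    bounded operators. Its continuity in operator norm then follows from that of \<open>H' i\<close>
    and of the scalars \<open>G i (y x $ i)\<close>, with no differentiability of
    \<open>G i\<close>.\<close>
  define y' where
    "y' x = (\<Sum>i\<in>UNIV. G i (y x $ i) *\<^sub>R (blinfun_scaleR_left (axis i 1 :: real ^ 'n) o\<^sub>L H' i x))" for x
  have y'_nth: "y' x h $ i = G i (y x $ i) * H' i x h" for x h i
    by (simp add: y'_def blinfun.sum_left blinfun.scaleR_left axis_def if_distrib[of "(*) _"] cong: if_cong)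
  have conty: "continuous_on W (\<lambda>x. y x $ i)" for i
    by (rule has_derivative_continuous_on[OF has_derivative_at_withinI[OF y']])
  have "continuous_on W (\<lambda>x. G i (y x $ i))" for i
    using yV by (intro continuous_on_compose2[OF assms(4) conty]) (auto simp: assms(3))
  then have "continuous_on W y'"
    unfolding y'_def using continuous_on_subset[OF contH' \<open>W \<subseteq> V2\<close>]
    by (intro continuous_intros bounded_bilinear.continuous_on[OF bounded_bilinear_blinfun_compose]) auto
  moreover have "(y has_derivative blinfun_apply (y' x)) (at x)" if "x \<in> W" for x
    unfolding has_derivative_componentwise_within[of y]
    using y'[OF that] by (auto simp: Basis_vec_def inner_axis y'_nth)
  ultimately have "C1_on y W"
    unfolding C1_on_def using \<open>open W\<close> by blast
  moreover have "partial_deriv j (\<lambda>x'. y x' $ i) x = F i j x (y x)" if "x \<in> W" for i j x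
  proof -
    have "x \<in> V2"
      using that \<open>W \<subseteq> V2\<close> by auto
    \<comment> \<open>Evaluated at \<open>axis j 1\<close>, the derivative of the component
      \<open>y x $ i\<close> is \<open>G i (y x $ i)\<close> times the partial derivative of
      \<open>H i\<close>.\<close>
    then show ?thesis
      using assms(6)[OF _ yV[OF that], of x i j] partial_deriv_eq[OF y'[OF that]] partial_deriv_eq[OF H']
      by simp
  qed
  moreover have "y x0 = y0"
    by (simp add: y_def \<phi>0 vec_eq_iff)
  ultimately show "\<exists>W y. open W \<and> x0 \<in> W \<and> W \<subseteq> V2 \<and>
           C1_on y W \<and> (\<forall>x\<in>W. y x \<in> V1) \<and>
           (\<forall>x\<in>W. \<forall>i j. partial_deriv j (\<lambda>x'. y x' $ i) x = F i j x (y x)) \<and>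
           y x0 = y0"
    using \<open>open W\<close> \<open>x0 \<in> W\<close> \<open>W \<subseteq> V2\<close> yV by blast
qed

end
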